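(* For every integer $n\ge 1$ there is a constant $C=C(n)$ such that for all $A,B\in GL^+(n,\mathbb{R})$ with $A\neq B$, $$d_{int}(A,B) < C\, d_{ext}(A,B).$$
   Context: $GL^+(n,\mathbb{R})$ denotes the set of real $n\times n$ matrices of positive determinant, regarded as an open subset of the space $\mathbb{R}^{n^2}$ of all real $n\times n$ matrices with its Euclidean metric (the sum of squares of the entries gives the squared norm). The extrinsic distance is $d_{ext}(A,B)=\|A-B\|$, the Euclidean distance in $\mathbb{R}^{n^2}$. The intrinsic distance $d_{int}(A,B)$ is the infimum of the Euclidean lengths of all (rectifiable) paths from $A$ to $B$ contained in $GL^+(n,\mathbb{R})$. *)

theory Defs
  imports "HOL-Analysis.Analysis"
begin

text \<open>
  The norm of \<^typ>\<open>real^'n^'n\<close> is the Euclidean norm of \<open>\<real>\<close> to the power \<open>n\<^sup>2\<close>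
  (not an operator norm), so \<^term>\<open>norm (A - B)\<close> is the extrinsic distance.
\<close>

lemma norm_matrix_power2:
  fixes A :: "real^'n^'m"
  shows "(norm A)\<^sup>2 = (\<Sum>i\<in>UNIV. \<Sum>j\<in>UNIV. (A $ i $ j)\<^sup>2)"
  by (simp add: norm_vec_def L2_set_def sum_nonneg)

definition GL_pos :: "(real^'n^'n) set" where
  "GL_pos = {A. det A > 0}"

text \<open>
  Length of a path on \<open>[0,1]\<close>: the supremum of the lengths of inscribed polygons, with vertices
  at the parameters listed by \<open>ts\<close>. It is \<open>\<infinity>\<close> for paths that are not rectifiable.
\<close>

definition path_length :: "(real \<Rightarrow> 'a::metric_space) \<Rightarrow> ennreal" where
  "path_length g =
     (SUP ts \<in> {ts. sorted ts \<and> set ts \<subseteq> {0..1}}.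
        \<Sum>i<length ts - 1. ennreal (dist (g (ts ! i)) (g (ts ! Suc i))))"

definition rectifiable :: "(real \<Rightarrow> 'a::metric_space) \<Rightarrow> bool" where
  "rectifiable g \<longleftrightarrow> path_length g < \<infinity>"

text \<open>
  The value is \<open>\<infinity>\<close> if no rectifiable path in \<open>S\<close> joins \<open>a\<close> to \<open>b\<close>.
\<close>

definition intrinsic_dist :: "'a::metric_space set \<Rightarrow> 'a \<Rightarrow> 'a \<Rightarrow> ennreal" where
  "intrinsic_dist S a b =
     (INF g \<in> {g. path g \<and> rectifiable g \<and> path_image g \<subseteq> S \<and> pathstart g = a \<and> pathfinish g = b}.
        path_length g)"

end

theory Submission
  imports Defs
begin

text \<open>
  The proof is Gaussian elimination with complete pivoting, by induction on the size of the
  matrices.  Write \<open>\<delta> = \<parallel>A - B\<parallel>\<close> and let \<open>m\<close> be the largest absolute value of an entry of \<open>A\<close>.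

  Suppose first that \<open>m\<close> is much larger than \<open>\<delta>\<close>.  The position of a largest entry of \<open>A\<close> is then a
  good pivot for \<open>A\<close> and for \<open>B\<close> alike.  A matrix is determined by its pivot row, its pivot column
  and the Schur complement of the pivot, and its determinant is the pivot times the determinant of
  the Schur complement.  The Schur complement subtracts \<open>column \<cdot> row / pivot\<close>, and this is a
  Lipschitz function of the matrix as long as the row and the column are bounded by a fixed multiple
  of the pivot.  Hence the Schur complements of \<open>A\<close> and \<open>B\<close> are \<open>O(\<delta>)\<close> apart; by induction the
  first can be carried to the second along a curve of length \<open>O(\<delta>)\<close> on which the determinant stays
  positive, with the pivot row and column of \<open>A\<close> kept fixed.  Afterwards the pivot row and column of
  \<open>A\<close> are moved linearly to those of \<open>B\<close> with the Schur complement kept fixed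
  (\<open>lipschitz_joined_of_pivot\<close>).  Signs are the only nuisance: the induction needs
  Schur complements of positive determinant, so the pivot must be positive, and it is convenient to
  have it on the diagonal.  At most two row operations with coefficients \<open>\<plusminus>2\<close>, applied to both \<open>A\<close>
  and \<open>B\<close>, achieve this; they preserve the determinant and change distances by bounded factors
  (\<open>lipschitz_joined_of_large_entry\<close>).

  If instead \<open>m = O(\<delta>)\<close>, then curves of length \<open>O(\<delta>)\<close> may move \<open>A\<close> and \<open>B\<close> separately.  The
  determinant is an affine function of a single entry, so one of the two directions of changing that
  entry does not decrease the determinant.  Going in this direction makes the entry as large as
  desired, up to its sign, which is again corrected by two row operations
  (\<open>lipschitz_joined_to_positive_pivot\<close>).  Now both matrices have a dominating positive pivot at the
  same diagonal place, and the pivot step applies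
  (\<open>lipschitz_joined_of_small_entries\<close>).
\<close>

section \<open>Lipschitz curves inside a set\<close>

text \<open>
  The Lipschitz constant stands for a bound on the length: in this form the bound passes through
  Lipschitz maps and concatenations without any partitions.
\<close>

definition lipschitz_joined :: "'a::metric_space set \<Rightarrow> real \<Rightarrow> 'a \<Rightarrow> 'a \<Rightarrow> bool" where
  "lipschitz_joined S L x y \<longleftrightarrow>
     (\<exists>g. L-lipschitz_on {0..1::real} g \<and> g ` {0..1} \<subseteq> S \<and> g 0 = x \<and> g 1 = y)"

text \<open>Each side is at most \<open>L\<close> times its parameter interval, and these intervals fit into \<open>[0,1]\<close>.\<close>

lemma sorted_polygon_length_le:
  fixes g :: "real \<Rightarrow> 'a::metric_space"
  assumes g: "L-lipschitz_on {0..1} g" and ts: "sorted ts" "set ts \<subseteq> {0..1}"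
  shows "(\<Sum>i<length ts - 1. dist (g (ts ! i)) (g (ts ! Suc i))) \<le> L"
proof -
  have L: "0 \<le> L"
    using g by (rule lipschitz_on_nonneg)
  show ?thesis
  proof (cases "ts = []")
    case True
    then show ?thesis using L by simp
  next
    case False
    have *: "dist (g (ts ! i)) (g (ts ! Suc i)) \<le> L * (ts ! Suc i - ts ! i)"
      if "i < length ts - 1" for i
    proof -
      have "ts ! i \<in> set ts" "ts ! Suc i \<in> set ts"
        using that by auto
      then have "ts ! i \<in> {0..1}" "ts ! Suc i \<in> {0..1}"
        using ts(2) by blast+
      moreover have "ts ! i \<le> ts ! Suc i"
        using ts that by (intro sorted_nth_mono) auto
      ultimately show ?thesis
        using lipschitz_onD[OF g, of "ts ! i" "ts ! Suc i"] by (simp add: dist_real_def)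
    qed
    have "(\<Sum>i<length ts - 1. dist (g (ts ! i)) (g (ts ! Suc i)))
        \<le> (\<Sum>i<length ts - 1. L * (ts ! Suc i - ts ! i))"
      using * by (intro sum_mono) auto
    also have "\<dots> = L * (ts ! (length ts - 1) - ts ! 0)"
      by (simp add: sum_distrib_left[symmetric] sum_lessThan_telescope)
    also have "\<dots> \<le> L * 1"
    proof (rule mult_left_mono[OF _ L])
      have "ts ! (length ts - 1) \<in> set ts" "ts ! 0 \<in> set ts"
        using False by auto
      then have "ts ! (length ts - 1) \<in> {0..1}" "ts ! 0 \<in> {0..1}"
        using ts(2) by blast+
      then show "ts ! (length ts - 1) - ts ! 0 \<le> 1" by simp
    qed
    finally show ?thesis by simp
  qed
qed

lemma intrinsic_dist_le_of_lipschitz_joined: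
  assumes "lipschitz_joined S L x y"
  shows "intrinsic_dist S x y \<le> ennreal L"
proof -
  obtain g where g: "L-lipschitz_on {0..1::real} g" "g ` {0..1} \<subseteq> S" "g 0 = x" "g 1 = y"
    using assms unfolding lipschitz_joined_def by blast
  have len: "path_length g \<le> ennreal L"
    unfolding path_length_def
  proof (rule SUP_least, clarify)
    fix ts :: "real list"
    assume "sorted ts" "set ts \<subseteq> {0..1}"
    then show "(\<Sum>i<length ts - 1. ennreal (dist (g (ts ! i)) (g (ts ! Suc i)))) \<le> ennreal L"
      using sorted_polygon_length_le[OF g(1)] by (subst sum_ennreal) (auto intro: ennreal_leI)
  qed
  have "path g"
    unfolding path_def using g(1) by (rule lipschitz_on_continuous_on)
  moreover have "rectifiable g"
    unfolding rectifiable_def using len by (auto simp: less_top[symmetric] top_unique)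
  ultimately have "intrinsic_dist S x y \<le> path_length g"
    unfolding intrinsic_dist_def using g
    by (intro INF_lower) (auto simp: path_image_def pathstart_def pathfinish_def)
  with len show ?thesis by order
qed

lemma lipschitz_joined_mono:
  assumes "lipschitz_joined S L x y" "L \<le> M" "S \<subseteq> T"
  shows "lipschitz_joined T M x y"
proof -
  obtain g where g: "L-lipschitz_on {0..1::real} g" "g ` {0..1} \<subseteq> S" "g 0 = x" "g 1 = y"
    using assms unfolding lipschitz_joined_def by blast
  have "M-lipschitz_on {0..1} g" "g ` {0..1} \<subseteq> T"
    using lipschitz_on_le[OF g(1) assms(2)] g(2) assms(3) by auto
  with g(3,4) show ?thesis
    unfolding lipschitz_joined_def by blast
qed

lemma lipschitz_joined_image:
  assumes "lipschitz_joined S L x y" and f: "K-lipschitz_on S f" "f ` S \<subseteq> T"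
  shows "lipschitz_joined T (K * L) (f x) (f y)"
proof -
  obtain g where g: "L-lipschitz_on {0..1::real} g" "g ` {0..1} \<subseteq> S" "g 0 = x" "g 1 = y"
    using assms unfolding lipschitz_joined_def by blast
  have "(K * L)-lipschitz_on {0..1} (\<lambda>t. f (g t))"
    using g(1) lipschitz_on_subset[OF f(1) g(2)] by (rule lipschitz_on_compose2)
  then show ?thesis
    unfolding lipschitz_joined_def using g f(2)
    by (intro exI[of _ "\<lambda>t. f (g t)"]) auto
qed

lemma lipschitz_joined_sym:
  assumes "lipschitz_joined S L x y"
  shows "lipschitz_joined S L y x"
proof -
  obtain g where g: "L-lipschitz_on {0..1::real} g" "g ` {0..1} \<subseteq> S" "g 0 = x" "g 1 = y"
    using assms unfolding lipschitz_joined_def by blast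
  have "L-lipschitz_on {0..1} (\<lambda>t. g (1 - t))"
  proof (rule lipschitz_onI)
    fix s t :: real assume "s \<in> {0..1}" "t \<in> {0..1}"
    then show "dist (g (1 - s)) (g (1 - t)) \<le> L * dist s t"
      using lipschitz_onD[OF g(1), of "1 - s" "1 - t"] by (simp add: dist_real_def abs_minus_commute)
  qed (rule lipschitz_on_nonneg[OF g(1)])
  then show ?thesis
    unfolding lipschitz_joined_def using g
    by (intro exI[of _ "\<lambda>t. g (1 - t)"]) auto
qed

lemma dist_le_of_lipschitz_joined:
  assumes "lipschitz_joined S L x y"
  shows "dist x y \<le> L"
proof -
  obtain g where g: "L-lipschitz_on {0..1::real} g" "g 0 = x" "g 1 = y"
    using assms unfolding lipschitz_joined_def by blast
  show ?thesis
    using lipschitz_onD[OF g(1), of 0 1] g by simp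
qed

lemma lipschitz_joined_trans:
  assumes xy: "lipschitz_joined S L x y" and yz: "lipschitz_joined S M y z"
  shows "lipschitz_joined S (L + M) x z"
proof -
  obtain f where f: "L-lipschitz_on {0..1::real} f" "f ` {0..1} \<subseteq> S" "f 0 = x" "f 1 = y"
    using xy unfolding lipschitz_joined_def by blast
  obtain g where g: "M-lipschitz_on {0..1::real} g" "g ` {0..1} \<subseteq> S" "g 0 = y" "g 1 = z"
    using yz unfolding lipschitz_joined_def by blast
  have LM: "0 \<le> L" "0 \<le> M"
    using f g lipschitz_on_nonneg by blast+
  consider "L = 0" | "M = 0" | "0 < L" "0 < M"
    using LM by linarith
  then show ?thesis
  proof cases
    case 1
    then show ?thesis using dist_le_of_lipschitz_joined[OF xy] yz by simp
  next
    case 2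
    then show ?thesis using dist_le_of_lipschitz_joined[OF yz] xy by simp
  next
    case 3
    \<comment> \<open>The concatenation runs at the constant speed \<open>L + M\<close>, changing curves at time \<open>c\<close>.\<close>
    define c where "c = L / (L + M)"
    have c: "0 < c" "c < 1" "1 - c = M / (L + M)"
      using 3 by (auto simp: c_def field_simps)
    define h1 where "h1 = (\<lambda>t. f (t / c))"
    define h2 where "h2 = (\<lambda>t. g ((t - c) / (1 - c)))"
    have scale: "dist (s / e) (t / e) = dist s t / e" if "0 < e" for s t e :: real
      using that by (simp only: dist_real_def diff_divide_distrib[symmetric] abs_divide abs_of_pos)
    have h1: "(L + M)-lipschitz_on {0..c} h1"
    proof (rule lipschitz_onI)
      fix s t assume "s \<in> {0..c}" "t \<in> {0..c}"
      then have "dist (f (s / c)) (f (t / c)) \<le> L * dist (s / c) (t / c)"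
        using c by (intro lipschitz_onD[OF f(1)]) (auto simp: field_simps)
      also have "dist (s / c) (t / c) = dist s t / c"
        using c by (intro scale) simp
      also have "L * (dist s t / c) = (L + M) * dist s t"
        using 3 by (simp add: c_def)
      finally show "dist (h1 s) (h1 t) \<le> (L + M) * dist s t" by (simp add: h1_def)
    qed (use LM in auto)
    have h2: "(L + M)-lipschitz_on {c..1} h2"
    proof (rule lipschitz_onI)
      fix s t assume "s \<in> {c..1}" "t \<in> {c..1}"
      then have "dist (h2 s) (h2 t) \<le> M * dist ((s - c) / (1 - c)) ((t - c) / (1 - c))"
        unfolding h2_def using c(1,2) by (intro lipschitz_onD[OF g(1)]) (auto simp: field_simps)
      also have "dist ((s - c) / (1 - c)) ((t - c) / (1 - c)) = dist s t / (1 - c)"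
        using c(2) by (subst scale) (auto simp: dist_real_def)
      also have "M * (dist s t / (1 - c)) = (L + M) * dist s t"
        using 3 by (simp add: c(3))
      finally show "dist (h2 s) (h2 t) \<le> (L + M) * dist s t" .
    qed (use LM in auto)
    have "(L + M)-lipschitz_on {0..1} (\<lambda>t. if t \<le> c then h1 t else h2 t)"
      using c by (intro lipschitz_on_concat[OF h1 h2]) (simp add: h1_def h2_def f g)
    moreover have "h1 t \<in> S" if "0 \<le> t" "t \<le> c" for t
      unfolding h1_def using that c(1) by (intro subsetD[OF f(2)] imageI) auto
    moreover have "h2 t \<in> S" if "c \<le> t" "t \<le> 1" for t
      unfolding h2_def using that c(2) by (intro subsetD[OF g(2)] imageI) auto
    ultimately show ?thesis
      unfolding lipschitz_joined_def using c(1,2) f g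
      by (intro exI[of _ "\<lambda>t. if t \<le> c then h1 t else h2 t"]) (auto simp: h1_def h2_def)
  qed
qed

lemma lipschitz_joined_segment:
  fixes x y :: "'a::real_normed_vector"
  assumes "\<And>t. 0 \<le> t \<Longrightarrow> t \<le> 1 \<Longrightarrow> x + t *\<^sub>R (y - x) \<in> S"
  shows "lipschitz_joined S (norm (x - y)) x y"
proof -
  have "(norm (x - y))-lipschitz_on {0..1} (\<lambda>t. x + t *\<^sub>R (y - x))"
  proof (rule lipschitz_onI)
    fix s t :: real
    have "(x + s *\<^sub>R (y - x)) - (x + t *\<^sub>R (y - x)) = (s - t) *\<^sub>R (y - x)"
      by (simp add: scaleR_left_diff_distrib)
    then show "dist (x + s *\<^sub>R (y - x)) (x + t *\<^sub>R (y - x)) \<le> norm (x - y) * dist s t"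
      by (simp add: dist_norm norm_minus_commute mult.commute)
  qed simp
  then show ?thesis
    unfolding lipschitz_joined_def using assms
    by (intro exI[of _ "\<lambda>t. x + t *\<^sub>R (y - x)"]) auto
qed

section \<open>Norms and entries of matrices\<close>

lemma norm_le_of_components_le:
  fixes v :: "real^'n"
  assumes "\<And>j. \<bar>v $ j\<bar> \<le> e"
  shows "norm v \<le> real CARD('n) * e"
proof -
  have "norm v \<le> (\<Sum>j\<in>UNIV. \<bar>v $ j\<bar>)"
    by (rule norm_le_l1_cart)
  also have "\<dots> \<le> (\<Sum>j\<in>(UNIV :: 'n set). e)"
    by (rule sum_mono) (rule assms)
  finally show ?thesis by simp
qed

lemma norm_le_of_entries_le:
  fixes X :: "real^'n^'m"
  assumes "\<And>i j. \<bar>X $ i $ j\<bar> \<le> e"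
  shows "norm X \<le> real CARD('m) * (real CARD('n) * e)"
proof -
  have "norm X \<le> (\<Sum>i\<in>UNIV. norm (X $ i))"
    by (simp add: norm_vec_def L2_set_le_sum)
  also have "\<dots> \<le> (\<Sum>i\<in>(UNIV :: 'm set). real CARD('n) * e)"
    by (intro sum_mono norm_le_of_components_le assms)
  finally show ?thesis by simp
qed

lemma entry_le_norm:
  fixes X :: "real^'n^'m"
  shows "\<bar>X $ i $ j\<bar> \<le> norm X"
  using component_le_norm_cart[of "X $ i" j] Finite_Cartesian_Product.norm_nth_le[of X i] by (meson order_trans)

section \<open>Blocks, single entries and row operations\<close>

text \<open>
  The group of \<open>I \<times> I\<close> matrices of positive determinant, embedded among the matrices of full size by
  completing with the identity.  In this way the induction runs over subsets \<open>I\<close> of one index type.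
\<close>

definition block_GL_pos :: "'n::finite set \<Rightarrow> (real^'n^'n) set" where
  "block_GL_pos I = {A. det A > 0 \<and>
     (\<forall>i j. i \<notin> I \<or> j \<notin> I \<longrightarrow> A $ i $ j = (if i = j then 1 else 0))}"

abbreviation entry_unit :: "'n \<Rightarrow> real^'n^'n" where
  "entry_unit p \<equiv> axis p (axis p 1)"

lemma entry_unit_nth: "entry_unit p $ i $ j = (if i = p \<and> j = p then 1 else 0)"
  by (auto simp: axis_def)

lemma det_affine_in_entry:
  fixes A :: "real^'n^'n"
  obtains c where "\<And>s. det (A + s *\<^sub>R entry_unit p) = det A + s * c"
proof
  fix s
  have "A + s *\<^sub>R entry_unit p = (\<chi> i. if i = p then A $ p + s *s axis p 1 else A $ i)"
    by (auto simp: vec_eq_iff axis_def)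
  then have "det (A + s *\<^sub>R entry_unit p) = det (\<chi> i. if i = p then A $ p else A $ i)
      + s * det (\<chi> i. if i = p then axis p 1 else A $ i)"
    by (simp add: det_row_add det_row_mul)
  also have "(\<chi> i. if i = p then A $ p else A $ i) = A"
    by (simp add: vec_eq_iff)
  finally show "det (A + s *\<^sub>R entry_unit p)
      = det A + s * det (\<chi> i. if i = p then axis p 1 else A $ i)" .
qed

lemma norm_axis_eq: "norm (axis i x) = norm x"
proof -
  have "(\<Sum>j\<in>UNIV. (norm (axis i x $ j))\<^sup>2) = (\<Sum>j\<in>UNIV. if j = i then (norm x)\<^sup>2 else 0)"
    by (intro sum.cong) (auto simp: axis_def)
  then show ?thesis by (simp add: norm_vec_def L2_set_def)
qed

text \<open>The row operation that adds \<open>t\<close> times row \<open>k\<close> to row \<open>i\<close>.\<close>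

definition shear :: "'n \<Rightarrow> 'n \<Rightarrow> real \<Rightarrow> real^'n^'n \<Rightarrow> real^'n^'n" where
  "shear i k t X = X + t *\<^sub>R axis i (X $ k)"

lemma shear_nth: "shear i k t X $ a $ b = (if a = i then X $ i $ b + t * X $ k $ b else X $ a $ b)"
  by (auto simp: shear_def axis_def)

lemma det_shear:
  assumes "i \<noteq> k"
  shows "det (shear i k t X) = det X"
proof -
  have "shear i k t X = (\<chi> a. if a = i then row i X + t *s row k X else row a X)"
    by (simp add: vec_eq_iff shear_nth row_def)
  then show ?thesis by (simp add: det_row_operation[OF assms])
qed

lemma shear_block_GL_pos:
  assumes "i \<noteq> k" "i \<in> I" "k \<in> I" "X \<in> block_GL_pos I"
  shows "shear i k t X \<in> block_GL_pos I"
  using assms by (auto simp: block_GL_pos_def det_shear shear_nth)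

lemma shear_inverse:
  assumes "i \<noteq> k"
  shows "shear i k (- t) (shear i k t X) = X"
  using assms by (auto simp: vec_eq_iff shear_nth)

lemma shear_diff: "shear i k t X - shear i k t Y = shear i k t (X - Y)"
  by (auto simp: vec_eq_iff shear_nth algebra_simps)

lemma norm_shear_le: "norm (shear i k t X) \<le> (1 + \<bar>t\<bar>) * norm X"
proof -
  have "norm (shear i k t X) \<le> norm X + norm (t *\<^sub>R axis i (X $ k))"
    unfolding shear_def by (rule norm_triangle_ineq)
  also have "norm (t *\<^sub>R axis i (X $ k)) = \<bar>t\<bar> * norm (X $ k)"
    by (simp add: norm_axis_eq)
  also have "\<dots> \<le> \<bar>t\<bar> * norm X"
    by (intro mult_left_mono Finite_Cartesian_Product.norm_nth_le) auto
  finally show ?thesis by (simp add: algebra_simps)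
qed

lemma norm_shear_diff_le: "norm (shear i k t X - shear i k t Y) \<le> (1 + \<bar>t\<bar>) * norm (X - Y)"
  unfolding shear_diff by (rule norm_shear_le)

text \<open>
  Undoing a row operation carries a curve between the transformed matrices back to one between the
  original ones, so \<open>A\<close> and \<open>B\<close> may be replaced by \<open>shear i k t A\<close> and \<open>shear i k t B\<close>.
\<close>

lemma lipschitz_joined_of_shear:
  assumes "i \<noteq> k" "i \<in> I" "k \<in> I"
    and "lipschitz_joined (block_GL_pos I) L (shear i k t A) (shear i k t B)"
  shows "lipschitz_joined (block_GL_pos I) ((1 + \<bar>t\<bar>) * L) A B"
proof -
  have "(1 + \<bar>t\<bar>)-lipschitz_on (block_GL_pos I) (shear i k (- t))"
    using norm_shear_diff_le[of i k "- t"] by (intro lipschitz_onI) (auto simp: dist_norm)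
  moreover have "shear i k (- t) ` block_GL_pos I \<subseteq> block_GL_pos I"
    using assms by (auto intro: shear_block_GL_pos)
  ultimately have "lipschitz_joined (block_GL_pos I) ((1 + \<bar>t\<bar>) * L)
      (shear i k (- t) (shear i k t A)) (shear i k (- t) (shear i k t B))"
    by (rule lipschitz_joined_image[OF assms(4)])
  then show ?thesis by (simp add: shear_inverse assms)
qed

text \<open>
  In contrast to the preceding lemma, here a single matrix travels to its own transform, by letting
  the coefficient grow from \<open>0\<close> to \<open>t\<close>.  Only the norm of row \<open>k\<close> enters the length; a bound by
  the norm of \<open>X\<close> would be too weak, since \<open>X\<close> contains an identity part outside \<open>I\<close>.
\<close>

lemma lipschitz_joined_shear:
  assumes "i \<noteq> k" "i \<in> I" "k \<in> I" "X \<in> block_GL_pos I"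
  shows "lipschitz_joined (block_GL_pos I) (\<bar>t\<bar> * norm (X $ k)) X (shear i k t X)"
proof -
  have "lipschitz_joined (block_GL_pos I) (norm (X - shear i k t X)) X (shear i k t X)"
  proof (rule lipschitz_joined_segment)
    fix u :: real
    have "X + u *\<^sub>R (shear i k t X - X) = shear i k (u * t) X"
      by (simp add: shear_def)
    then show "X + u *\<^sub>R (shear i k t X - X) \<in> block_GL_pos I"
      using assms by (simp add: shear_block_GL_pos)
  qed
  then show ?thesis by (simp add: shear_def norm_axis_eq)
qed

section \<open>Elimination of a dominating pivot\<close>

text \<open>
  The rank-one matrix that Gaussian elimination with pivot \<open>(p, p)\<close> subtracts.  It agrees with \<open>A\<close>
  in row \<open>p\<close> and in column \<open>p\<close>, so that \<open>A - pivot_outer p A + entry_unit p\<close> is the Schur complement of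
  the pivot, completed by \<open>1\<close> at the place \<open>(p, p)\<close>.
\<close>

definition pivot_outer :: "'n \<Rightarrow> real^'n^'n \<Rightarrow> real^'n^'n" where
  "pivot_outer p A = (\<chi> i j. A $ i $ p * A $ p $ j / A $ p $ p)"

definition pivot_dominates :: "'n \<Rightarrow> real \<Rightarrow> (real^'n^'n) set" where
  "pivot_dominates p M = {A. A $ p $ p > 0 \<and>
     (\<forall>i. \<bar>A $ i $ p\<bar> \<le> M * A $ p $ p \<and> \<bar>A $ p $ i\<bar> \<le> M * A $ p $ p)}"

text \<open>
  The matrix on the left has the block decomposition \<open>L ** X ** U\<close>, with \<open>X\<close> in the role of the
  Schur complement: \<open>L\<close> is the identity with column \<open>p\<close> replaced by that of \<open>A\<close>, and \<open>U\<close> is the identity with row \<open>p\<close>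
  replaced by that of \<open>A\<close> divided by the pivot.
\<close>

lemma det_attach_pivot:
  fixes A X :: "real^'n^'n"
  assumes a: "A $ p $ p \<noteq> 0"
    and X: "\<And>i. X $ i $ p = (if i = p then 1 else 0)" "\<And>j. X $ p $ j = (if j = p then 1 else 0)"
  shows "det (X - entry_unit p + pivot_outer p A) = A $ p $ p * det X"
proof -
  define L :: "real^'n^'n" where
    "L = (\<chi> i j. if j = p then A $ i $ p else mat 1 $ i $ j)"
  define U :: "real^'n^'n" where
    "U = transpose (\<chi> i j. if j = p then A $ p $ i / A $ p $ p else mat 1 $ i $ j)"
  have "det L = A $ p $ p"
    using cramer_lemma[of p "mat 1" "column p A"]
    by (simp add: L_def column_def matrix_vector_mul_lid del: cramer_lemma cong: if_cong)
  have "det U = 1"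
    using cramer_lemma[of p "mat 1" "\<chi> k. A $ p $ k / A $ p $ p"] a
    by (simp add: U_def det_transpose matrix_vector_mul_lid del: cramer_lemma cong: if_cong)
  have L: "L $ i $ k = (if k = i then 1 else 0) + (if k = p then A $ i $ p - (if i = p then 1 else 0) else 0)" for i k
    by (auto simp: L_def mat_def)
  have U: "U $ k $ j = (if k = j then 1 else 0) + (if k = p then A $ p $ j / A $ p $ p - (if j = p then 1 else 0) else 0)" for k j
    by (auto simp: U_def mat_def transpose_def)
  have LX: "(L ** X) $ i $ j = X $ i $ j + (A $ i $ p - (if i = p then 1 else 0)) * X $ p $ j" for i j
    unfolding matrix_matrix_mult_def
    by (simp add: L distrib_right sum.distrib if_distrib[where f = "\<lambda>x. x * _"] cong: if_cong)
  have LXU: "((L ** X) ** U) $ i $ j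
      = (L ** X) $ i $ j + (L ** X) $ i $ p * (A $ p $ j / A $ p $ p - (if j = p then 1 else 0))" for i j
    unfolding matrix_matrix_mult_def[of "L ** X" U]
    by (simp add: U distrib_left sum.distrib if_distrib[where f = "\<lambda>x. _ * x"] cong: if_cong)
  have "((L ** X) ** U) $ i $ j = (X - entry_unit p + pivot_outer p A) $ i $ j" for i j
    unfolding LXU
    by (cases "i = p"; cases "j = p") (use a in \<open>simp_all add: LX X axis_def pivot_outer_def field_simps\<close>)
  then have "(L ** X) ** U = X - entry_unit p + pivot_outer p A"
    by (simp add: vec_eq_iff)
  then show ?thesis
    using det_mul[of "L ** X" U] det_mul[of L X] \<open>det L = _\<close> \<open>det U = _\<close> by simp
qed

text \<open>
  The entries \<open>x * y / a\<close> of the rank-one matrix have partial derivatives \<open>y / a\<close>, \<open>x / a\<close> and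
  \<open>- (x / a) * (y / a)\<close>, which are bounded by \<open>M\<close>, \<open>M\<close> and \<open>M\<^sup>2\<close>
  uniformly over pivots of all sizes.  The proof writes this out for difference quotients.
\<close>

lemma lipschitz_on_pivot_outer:
  fixes p :: "'n::finite"
  assumes "0 \<le> M"
  shows "(real CARD('n) * (real CARD('n) * (M\<^sup>2 + 2 * M)))-lipschitz_on (pivot_dominates p M) (pivot_outer p)"
proof (rule lipschitz_onI)
  fix A B :: "real^'n^'n"
  assume A: "A \<in> pivot_dominates p M" and B: "B \<in> pivot_dominates p M"
  define a where "a = A $ p $ p"
  define b where "b = B $ p $ p"
  let ?d = "norm (A - B)"
  have pos: "0 < a" "0 < b"
    using A B by (auto simp: pivot_dominates_def a_def b_def)
  have d: "\<bar>A $ i $ j - B $ i $ j\<bar> \<le> ?d" for i j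
    using entry_le_norm[of "A - B" i j] by simp
  have "\<bar>(pivot_outer p A - pivot_outer p B) $ i $ j\<bar> \<le> (M\<^sup>2 + 2 * M) * ?d" for i j
  proof -
    have 1: "\<bar>A $ p $ j / a\<bar> \<le> M" "\<bar>B $ i $ p / b\<bar> \<le> M"
      using A B pos by (auto simp: pivot_dominates_def a_def b_def field_simps)
    have "(pivot_outer p A - pivot_outer p B) $ i $ j
        = (A $ i $ p - B $ i $ p) * (A $ p $ j / a) + (B $ i $ p / b) * (A $ p $ j - B $ p $ j)
          + (B $ i $ p / b) * (A $ p $ j / a) * (b - a)"
      using pos by (simp add: pivot_outer_def a_def[symmetric] b_def[symmetric] field_simps)
    also have "\<bar>\<dots>\<bar> \<le> \<bar>(A $ i $ p - B $ i $ p) * (A $ p $ j / a)\<bar> + \<bar>(B $ i $ p / b) * (A $ p $ j - B $ p $ j)\<bar>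
          + \<bar>(B $ i $ p / b) * (A $ p $ j / a) * (b - a)\<bar>"
      by linarith
    also have "\<dots> \<le> ?d * M + M * ?d + M * M * ?d"
      unfolding abs_mult
      using 1 d[of i p] d[of p j] d[of p p] assms
      by (intro add_mono mult_mono) (auto simp: a_def b_def abs_minus_commute)
    finally show ?thesis by (simp add: power2_eq_square algebra_simps)
  qed
  then have "norm (pivot_outer p A - pivot_outer p B) \<le> real CARD('n) * (real CARD('n) * ((M\<^sup>2 + 2 * M) * ?d))"
    by (rule norm_le_of_entries_le)
  then show "dist (pivot_outer p A) (pivot_outer p B)
      \<le> real CARD('n) * (real CARD('n) * (M\<^sup>2 + 2 * M)) * dist A B"
    by (simp add: dist_norm algebra_simps)
qed (use assms in auto)

lemma convex_pivot_dominates: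
  assumes "A \<in> pivot_dominates p M" "B \<in> pivot_dominates p M" "0 \<le> t" "t \<le> 1"
  shows "A + t *\<^sub>R (B - A) \<in> pivot_dominates p M"
proof -
  have conv: "x + t * (y - x) = (1 - t) * x + t * y" for x y :: real
    by (simp add: algebra_simps)
  have *: "\<bar>(1 - t) * x + t * y\<bar> \<le> M * ((1 - t) * a + t * b)"
    if "\<bar>x\<bar> \<le> M * a" "\<bar>y\<bar> \<le> M * b" for x y a b
  proof -
    have "\<bar>(1 - t) * x + t * y\<bar> \<le> (1 - t) * \<bar>x\<bar> + t * \<bar>y\<bar>"
      using assms(3,4) abs_triangle_ineq[of "(1 - t) * x" "t * y"] by (simp add: abs_mult)
    also have "\<dots> \<le> (1 - t) * (M * a) + t * (M * b)"
      using assms(3,4) that by (intro add_mono mult_left_mono) auto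
    finally show ?thesis by (simp add: algebra_simps)
  qed
  have "0 < (1 - t) * A $ p $ p + t * B $ p $ p"
  proof (cases "t = 0")
    case True
    then show ?thesis using assms(1) by (simp add: pivot_dominates_def)
  next
    case False
    then show ?thesis
      using assms by (intro add_nonneg_pos) (auto simp: pivot_dominates_def)
  qed
  then show ?thesis
    using assms(1,2) * by (simp add: pivot_dominates_def conv)
qed

text \<open>
  The pivot step.  The curve has two pieces: the first moves the Schur complement of \<open>A\<close> to that of
  \<open>B\<close> by the hypothesis on smaller blocks, with the pivot row and column of \<open>A\<close> kept fixed; the
  second moves the pivot row and column along a segment, with the Schur complement of \<open>B\<close> kept fixed.
\<close>

lemma lipschitz_joined_of_pivot:
  fixes A B :: "real^'n^'n"
  defines "\<kappa> \<equiv> \<lambda>M. real CARD('n) * (real CARD('n) * (M\<^sup>2 + 2 * M))"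
  assumes p: "p \<in> I" and M: "0 \<le> M" and C: "0 \<le> C"
    and minor: "\<And>X Y. X \<in> block_GL_pos (I - {p}) \<Longrightarrow> Y \<in> block_GL_pos (I - {p}) \<Longrightarrow>
           lipschitz_joined (block_GL_pos (I - {p})) (C * norm (X - Y)) X Y"
    and A: "A \<in> block_GL_pos I" "A \<in> pivot_dominates p M"
    and B: "B \<in> block_GL_pos I" "B \<in> pivot_dominates p M"
  shows "lipschitz_joined (block_GL_pos I) ((C * (1 + \<kappa> M) + \<kappa> M) * norm (A - B)) A B"
proof -
  \<comment> \<open>The second piece runs through the rank-one parts of the segment from \<open>A\<close> to \<open>B\<close>.  The determinant
    may vanish on this segment, so the argument needs a set containing it on which only the
    pivot row and column are controlled.\<close>
  define W where "W = {X \<in> pivot_dominates p M. \<forall>i. i \<notin> I \<longrightarrow> X $ i $ p = 0 \<and> X $ p $ i = (0::real)}"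
  \<comment> \<open>the Schur complement of the pivot, completed by the identity\<close>
  define S where "S = (\<lambda>X. X - pivot_outer p X + entry_unit p)"
  have W: "A \<in> W" "B \<in> W"
    using A B p by (auto simp: W_def block_GL_pos_def)
  have attach: "Y - entry_unit p + pivot_outer p X \<in> block_GL_pos I"
    if Y: "Y \<in> block_GL_pos (I - {p})" and X: "X \<in> W" for X Y
  proof -
    have "det (Y - entry_unit p + pivot_outer p X) = X $ p $ p * det Y"
      using X Y by (intro det_attach_pivot) (auto simp: W_def pivot_dominates_def block_GL_pos_def)
    then have "0 < det (Y - entry_unit p + pivot_outer p X)"
      using X Y by (auto simp: W_def pivot_dominates_def block_GL_pos_def)
    moreover have "(Y - entry_unit p + pivot_outer p X) $ i $ j = (if i = j then 1 else 0)"
      if "i \<notin> I \<or> j \<notin> I" for i j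
      using that X Y p by (auto simp: W_def block_GL_pos_def entry_unit_nth pivot_outer_def)
    ultimately show ?thesis by (simp add: block_GL_pos_def)
  qed
  have minor_of: "S X \<in> block_GL_pos (I - {p})" if X: "X \<in> block_GL_pos I" "X \<in> W" for X
  proof -
    have pos: "0 < X $ p $ p"
      using X by (simp add: W_def pivot_dominates_def)
    have entries: "S X $ i $ j = (if i = j then 1 else 0)" if "i \<notin> I - {p} \<or> j \<notin> I - {p}" for i j
      using that X pos by (auto simp: S_def W_def block_GL_pos_def entry_unit_nth pivot_outer_def)
    have "det X = det (S X - entry_unit p + pivot_outer p X)"
      by (simp add: S_def)
    also have "\<dots> = X $ p $ p * det (S X)"
      using pos by (intro det_attach_pivot) (auto simp: entries)
    finally show ?thesis
      using X pos entries by (simp add: block_GL_pos_def zero_less_mult_iff)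
  qed
  have \<kappa>: "0 \<le> \<kappa> M"
    using M by (simp add: \<kappa>_def)
  have outer: "(\<kappa> M)-lipschitz_on W (pivot_outer p)"
    unfolding \<kappa>_def using lipschitz_on_pivot_outer[OF M]
    by (rule lipschitz_on_subset) (auto simp: W_def)
  have "norm (S A - S B) \<le> norm (A - B) + norm (pivot_outer p A - pivot_outer p B)"
    using norm_triangle_ineq4[of "A - B" "pivot_outer p A - pivot_outer p B"]
    by (simp add: S_def algebra_simps)
  also have "\<dots> \<le> (1 + \<kappa> M) * norm (A - B)"
    using lipschitz_onD[OF outer W] by (simp add: dist_norm algebra_simps)
  finally have "C * norm (S A - S B) \<le> C * (1 + \<kappa> M) * norm (A - B)"
    using C by (simp add: mult_left_mono mult.assoc)
  then have "lipschitz_joined (block_GL_pos (I - {p})) (C * (1 + \<kappa> M) * norm (A - B)) (S A) (S B)"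
    by (rule lipschitz_joined_mono[OF minor[OF minor_of minor_of, OF A(1) W(1) B(1) W(2)]]) simp
  then have "lipschitz_joined (block_GL_pos I) (1 * (C * (1 + \<kappa> M) * norm (A - B)))
      (S A - entry_unit p + pivot_outer p A) (S B - entry_unit p + pivot_outer p A)"
    by (rule lipschitz_joined_image) (auto intro!: lipschitz_onI attach W(1) simp: dist_norm)
  then have 1: "lipschitz_joined (block_GL_pos I) (C * (1 + \<kappa> M) * norm (A - B))
      A (S B - entry_unit p + pivot_outer p A)"
    by (simp add: S_def)
  have "lipschitz_joined W (norm (A - B)) A B"
    using W by (intro lipschitz_joined_segment) (auto simp: W_def convex_pivot_dominates)
  then have "lipschitz_joined (block_GL_pos I) (\<kappa> M * norm (A - B))
      (S B - entry_unit p + pivot_outer p A) (S B - entry_unit p + pivot_outer p B)"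
  proof (rule lipschitz_joined_image)
    show "(\<kappa> M)-lipschitz_on W (\<lambda>X. S B - entry_unit p + pivot_outer p X)"
      using lipschitz_onD[OF outer] \<kappa> by (intro lipschitz_onI) (auto simp: dist_norm)
    show "(\<lambda>X. S B - entry_unit p + pivot_outer p X) ` W \<subseteq> block_GL_pos I"
      using attach minor_of[OF B(1) W(2)] by auto
  qed
  then have "lipschitz_joined (block_GL_pos I) (\<kappa> M * norm (A - B))
      (S B - entry_unit p + pivot_outer p A) B"
    by (simp add: S_def)
  from lipschitz_joined_trans[OF 1 this] show ?thesis
    by (simp add: algebra_simps)
qed

section \<open>Producing a positive pivot\<close>

text \<open>
  The row operations below increase entries bounded by \<open>m\<close> to at most \<open>7 * m\<close>.  A perturbation of
  size \<open>m / 2\<close> leaves entries of at most \<open>15 * (m / 2)\<close> against a pivot of at least \<open>m / 2\<close>, which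
  explains the ratio \<open>15\<close>.
\<close>

lemma pivot_dominates_nearby:
  fixes A B :: "real^'n^'n"
  assumes "0 < m" "m \<le> A $ p $ p" "\<And>a. \<bar>A $ a $ p\<bar> \<le> 7 * m" "\<And>a. \<bar>A $ p $ a\<bar> \<le> 7 * m"
    and "norm (A - B) \<le> m / 2"
  shows "B \<in> pivot_dominates p 15"
proof -
  have near: "\<bar>A $ i $ j - B $ i $ j\<bar> \<le> m / 2" for i j
    using entry_le_norm[of "A - B" i j] assms(5) by simp
  have "0 < B $ p $ p"
    using near[of p p] assms(1,2) by linarith
  moreover have "\<bar>B $ a $ p\<bar> \<le> 15 * B $ p $ p" "\<bar>B $ p $ a\<bar> \<le> 15 * B $ p $ p" for a
    using near[of p p] near[of a p] near[of p a] assms(2) assms(3,4)[of a] by linarith+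
  ultimately show ?thesis
    by (simp add: pivot_dominates_def)
qed

text \<open>
  Turning a negative pivot into a positive one: subtracting twice row \<open>p\<close> from another row \<open>i\<close>
  makes the entry \<open>(i, p)\<close> at least \<open>2 * m - m = m\<close>, and then adding twice row \<open>i\<close> to row \<open>p\<close> makes
  the pivot at least \<open>- m + 2 * m = m\<close>.
\<close>

lemma negative_pivot_shears:
  fixes X :: "real^'n^'n"
  assumes X: "X \<in> block_GL_pos I" and pi: "p \<in> I" "i \<in> I" "i \<noteq> p"
    and m: "0 \<le> m" "\<And>a j. a \<in> I \<Longrightarrow> \<bar>X $ a $ j\<bar> \<le> m" and pp: "X $ p $ p = - m"
  defines "Y \<equiv> shear p i 2 (shear i p (- 2) X)"
  shows "m \<le> Y $ p $ p" "\<bar>Y $ a $ p\<bar> \<le> 7 * m" "\<bar>Y $ p $ a\<bar> \<le> 7 * m"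
proof -
  show "m \<le> Y $ p $ p"
    using m(2)[OF pi(2), of p] m(2)[OF pi(1), of p] pp pi(3) by (simp add: Y_def shear_nth)
  have zero: "X $ a $ p = 0" if "a \<notin> I"
    using X that pi(1) by (auto simp: block_GL_pos_def)
  show "\<bar>Y $ a $ p\<bar> \<le> 7 * m"
  proof (cases "a \<in> I")
    case True
    then show ?thesis
      using m(2)[OF pi(2), of p] m(2)[OF pi(1), of p] m(2)[of a p] pi(3) m(1)
      by (auto simp: Y_def shear_nth abs_le_iff)
  next
    case False
    then show ?thesis
      using zero pi m(1) by (auto simp: Y_def shear_nth)
  qed
  show "\<bar>Y $ p $ a\<bar> \<le> 7 * m"
    using m(2)[OF pi(2), of a] m(2)[OF pi(1), of a] pi(3)
    by (auto simp: Y_def shear_nth abs_le_iff)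
qed

text \<open>
  A matrix with entries at most \<open>R\<close> can afford a curve of length proportional to \<open>R\<close>.  The sign of
  the cofactor \<open>c\<close> decides whether its \<open>(p, p)\<close> entry is moved to \<open>R\<close> or to \<open>- R\<close> without decreasing
  the determinant.
\<close>

lemma lipschitz_joined_to_positive_pivot:
  fixes A :: "real^'n^'n"
  assumes A: "A \<in> block_GL_pos I" and pi: "p \<in> I" "i \<in> I" "i \<noteq> p"
    and R: "0 < R" "\<And>a j. a \<in> I \<Longrightarrow> \<bar>A $ a $ j\<bar> \<le> R"
  obtains B where "B \<in> block_GL_pos I" "B \<in> pivot_dominates p 15"
    "lipschitz_joined (block_GL_pos I) ((2 + 8 * real CARD('n)) * R) A B"
proof -
  obtain c where c: "\<And>s. det (A + s *\<^sub>R entry_unit p) = det A + s * c"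
    by (rule det_affine_in_entry[of A p]) blast
  define move where "move = (\<lambda>r. A + (r - A $ p $ p) *\<^sub>R entry_unit p)"
  have in_block: "A + s *\<^sub>R entry_unit p \<in> block_GL_pos I" if "0 \<le> s * c" for s
    using A pi(1) that by (auto simp: block_GL_pos_def c entry_unit_nth)
  have App: "\<bar>A $ p $ p\<bar> \<le> R"
    using R(2)[OF pi(1)] .
  have joined: "lipschitz_joined (block_GL_pos I) (2 * R) A (move r)"
    if "0 \<le> (r - A $ p $ p) * c" "\<bar>r\<bar> \<le> R" for r
  proof -
    have "lipschitz_joined (block_GL_pos I) (norm (A - move r)) A (move r)"
    proof (rule lipschitz_joined_segment)
      fix u :: real assume "0 \<le> u"
      then have "0 \<le> u * (r - A $ p $ p) * c"
        using that(1) by (simp add: mult.assoc)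
      from in_block[OF this] show "A + u *\<^sub>R (move r - A) \<in> block_GL_pos I"
        by (simp add: move_def)
    qed
    moreover have "norm (A - move r) \<le> 2 * R"
      using that(2) App by (simp add: move_def norm_axis_eq)
    ultimately show ?thesis by (rule lipschitz_joined_mono) simp
  qed
  have move_nth: "move r $ a $ j = (if a = p \<and> j = p then r else A $ a $ j)" for r a j
    by (auto simp: move_def entry_unit_nth)
  have move_le: "\<bar>move r $ a $ j\<bar> \<le> R" if "\<bar>r\<bar> \<le> R" "a \<in> I" for r a j
    using R(2)[OF that(2)] that(1) by (simp add: move_nth)
  have N: "0 \<le> real CARD('n) * R"
    using R(1) by simp
  show ?thesis
  proof (cases "0 \<le> c")
    case True
    then have sgn: "0 \<le> (R - A $ p $ p) * c"
      using App by simp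
    show ?thesis
    proof
      show "move R \<in> block_GL_pos I"
        unfolding move_def by (rule in_block[OF sgn])
      have "\<bar>move R $ a $ p\<bar> \<le> 7 * R" "\<bar>move R $ p $ a\<bar> \<le> 7 * R" for a
        using move_le[of R a p] move_le[of R p a] pi(1) R(1) A
        by (cases "a \<in> I"; force simp: block_GL_pos_def move_nth)+
      then show "move R \<in> pivot_dominates p 15"
        using R(1) by (intro pivot_dominates_nearby[of R "move R"]) (auto simp: move_nth)
      show "lipschitz_joined (block_GL_pos I) ((2 + 8 * real CARD('n)) * R) A (move R)"
        using N R(1) by (intro lipschitz_joined_mono[OF joined[OF sgn]]) (auto simp: algebra_simps)
    qed
  next
    case False
    then have sgn: "0 \<le> (- R - A $ p $ p) * c"
      using App by (intro mult_nonpos_nonpos) auto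
    define X where "X = move (- R)"
    define Y where "Y = shear i p (- 2) X"
    define Z where "Z = shear p i 2 Y"
    have X: "X \<in> block_GL_pos I"
      unfolding X_def move_def by (rule in_block[OF sgn])
    have Y: "Y \<in> block_GL_pos I"
      unfolding Y_def using X pi by (intro shear_block_GL_pos) auto
    have X_le: "\<bar>X $ a $ j\<bar> \<le> R" if "a \<in> I" for a j
      unfolding X_def using R(1) that by (intro move_le) auto
    have Y_le: "\<bar>Y $ i $ j\<bar> \<le> 3 * R" for j
      using X_le[OF pi(1), of j] X_le[OF pi(2), of j] by (simp add: Y_def shear_nth)
    have Xpp: "X $ p $ p = - R"
      by (simp add: X_def move_nth)
    show ?thesis
    proof
      show "Z \<in> block_GL_pos I"
        unfolding Z_def using Y pi by (intro shear_block_GL_pos) auto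
      show "Z \<in> pivot_dominates p 15"
        using negative_pivot_shears[OF X pi _ X_le Xpp] R(1)
        by (intro pivot_dominates_nearby[of R Z]) (auto simp: Z_def Y_def)
      have "lipschitz_joined (block_GL_pos I) (2 * R) A X"
        unfolding X_def using R(1) by (intro joined sgn) simp
      moreover have "lipschitz_joined (block_GL_pos I) (\<bar>- 2\<bar> * norm (X $ p)) X Y"
        unfolding Y_def using X pi by (intro lipschitz_joined_shear) auto
      moreover have "lipschitz_joined (block_GL_pos I) (\<bar>2\<bar> * norm (Y $ i)) Y Z"
        unfolding Z_def using Y pi by (intro lipschitz_joined_shear) auto
      ultimately have "lipschitz_joined (block_GL_pos I)
          (2 * R + \<bar>- 2\<bar> * norm (X $ p) + \<bar>2\<bar> * norm (Y $ i)) A Z"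
        by (metis lipschitz_joined_trans)
      moreover have "norm (X $ p) \<le> real CARD('n) * R" "norm (Y $ i) \<le> real CARD('n) * (3 * R)"
        using X_le[OF pi(1)] Y_le by (intro norm_le_of_components_le; blast)+
      ultimately show "lipschitz_joined (block_GL_pos I) ((2 + 8 * real CARD('n)) * R) A Z"
        by (elim lipschitz_joined_mono) (auto simp: algebra_simps)
    qed
  qed
qed

section \<open>The induction over blocks\<close>

text \<open>The determinant is affine along the segment, hence positive between two positive values.\<close>

lemma lipschitz_joined_single_entry:
  assumes A: "A \<in> block_GL_pos I" and B: "B \<in> block_GL_pos I" and p: "I \<subseteq> {p}"
  shows "lipschitz_joined (block_GL_pos I) (norm (A - B)) A B"
proof -
  obtain c where c: "\<And>s. det (A + s *\<^sub>R entry_unit p) = det A + s * c"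
    by (rule det_affine_in_entry[of A p]) blast
  define s where "s = B $ p $ p - A $ p $ p"
  have "B $ i $ j = A $ i $ j" if "i \<noteq> p \<or> j \<noteq> p" for i j
  proof -
    have "i \<notin> I \<or> j \<notin> I"
      using that p by blast
    then show ?thesis
      using A B by (simp add: block_GL_pos_def)
  qed
  then have BA: "B - A = s *\<^sub>R entry_unit p"
    by (auto simp: vec_eq_iff s_def entry_unit_nth)
  have "det B = det A + s * c"
    using c[of s] BA[symmetric] by simp
  show ?thesis
  proof (rule lipschitz_joined_segment)
    fix t :: real assume t: "0 \<le> t" "t \<le> 1"
    have "det (A + t *\<^sub>R (B - A)) = (1 - t) * det A + t * det B"
      using c[of "t * s"] \<open>det B = _\<close> by (simp add: BA algebra_simps)
    also have "\<dots> > 0"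
    proof (cases "t = 0")
      case False
      then show ?thesis
        using t A B by (intro add_nonneg_pos) (auto simp: block_GL_pos_def)
    qed (use A in \<open>simp add: block_GL_pos_def\<close>)
    finally show "A + t *\<^sub>R (B - A) \<in> block_GL_pos I"
      using A B by (auto simp: block_GL_pos_def)
  qed
qed

text \<open>
  The row operations that bring the largest entry of \<open>A\<close> to a positive diagonal place are applied to
  \<open>A\<close> and \<open>B\<close> simultaneously.  They enlarge \<open>norm (A - B)\<close> by a factor of at most \<open>3\<^sup>2 = 9\<close>, and with
  \<open>18 * norm (A - B) \<le> m\<close> the images are still within \<open>m / 2\<close> of each other.  Transporting the curve
  back costs another factor of at most \<open>9\<close>, which gives \<open>81\<close>.
\<close>

lemma lipschitz_joined_of_large_entry:
  fixes A B :: "real^'n^'n"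
  assumes A: "A \<in> block_GL_pos I" and B: "B \<in> block_GL_pos I"
    and pq: "p \<in> I" "q \<in> I" and other: "\<exists>i\<in>I. i \<noteq> p"
    and le_m: "\<And>a j. a \<in> I \<Longrightarrow> \<bar>A $ a $ j\<bar> \<le> \<bar>A $ p $ q\<bar>"
    and m: "0 < \<bar>A $ p $ q\<bar>" and close: "18 * norm (A - B) \<le> \<bar>A $ p $ q\<bar>"
    and D: "0 \<le> D"
    and pivot: "\<And>r X Y. r \<in> I \<Longrightarrow> X \<in> block_GL_pos I \<Longrightarrow> Y \<in> block_GL_pos I \<Longrightarrow>
      X \<in> pivot_dominates r 15 \<Longrightarrow> Y \<in> pivot_dominates r 15 \<Longrightarrow>
      lipschitz_joined (block_GL_pos I) (D * norm (X - Y)) X Y"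
  shows "lipschitz_joined (block_GL_pos I) (81 * D * norm (A - B)) A B"
proof -
  define m where "m = \<bar>A $ p $ q\<bar>"
  define \<delta> where "\<delta> = norm (A - B)"
  note le_m = le_m[folded m_def] and m = m[folded m_def] and close = close[folded m_def \<delta>_def]
  have \<delta>: "0 \<le> \<delta>"
    by (simp add: \<delta>_def)
  have weaken: "lipschitz_joined (block_GL_pos I) (81 * D * norm (A - B)) A B"
    if "lipschitz_joined (block_GL_pos I) (c * D * \<delta>) A B" "c \<le> 81" for c
    using that \<delta> D
    by (intro lipschitz_joined_mono[OF that(1)]) (auto simp: \<delta>_def intro!: mult_right_mono)
  have zero: "A $ a $ j = 0" if "a \<notin> I" "j \<in> I" for a j
    using that A by (auto simp: block_GL_pos_def)
  have near: "lipschitz_joined (block_GL_pos I) (D * norm (X - Y)) X Y"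
    if "r \<in> I" "X \<in> block_GL_pos I" "Y \<in> block_GL_pos I" "m \<le> X $ r $ r"
      "\<And>a. \<bar>X $ a $ r\<bar> \<le> 7 * m" "\<And>a. \<bar>X $ r $ a\<bar> \<le> 7 * m" "norm (X - Y) \<le> m / 2" for r X Y
    using that m pivot_dominates_nearby[of m X r]
    by (intro pivot[of r]) auto
  consider "p \<noteq> q" | "p = q" "A $ p $ p = m" | "p = q" "A $ p $ p = - m"
    unfolding m_def by force
  then show ?thesis
  proof cases
    case 1
    \<comment> \<open>The factor \<open>2\<close> outweighs whatever the entry \<open>(q, q)\<close> contains, and the sign makes the
      result positive.\<close>
    define t where "t = 2 * sgn (A $ p $ q)"
    have t: "\<bar>t\<bar> = 2" "t * A $ p $ q = 2 * m"
      using m by (auto simp: t_def m_def sgn_if)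
    define X where "X = shear q p t A"
    define Y where "Y = shear q p t B"
    have XY: "norm (X - Y) \<le> 3 * \<delta>"
      using norm_shear_diff_le[of q p t A B] t(1) by (simp add: X_def Y_def \<delta>_def)
    have tle: "\<bar>t * A $ p $ a\<bar> \<le> 2 * m" for a
      using le_m[OF pq(1), of a] t(1) by (simp add: abs_mult)
    have "lipschitz_joined (block_GL_pos I) (D * norm (X - Y)) X Y"
    proof (rule near[of q])
      show "X \<in> block_GL_pos I" "Y \<in> block_GL_pos I"
        unfolding X_def Y_def using A B pq 1 by (auto intro: shear_block_GL_pos)
      show "m \<le> X $ q $ q"
        using le_m[OF pq(2), of q] t(2) by (simp add: X_def shear_nth)
      show "\<bar>X $ q $ a\<bar> \<le> 7 * m" for a
        using le_m[OF pq(2), of a] tle[of a] m by (simp add: X_def shear_nth)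
      then show "\<bar>X $ a $ q\<bar> \<le> 7 * m" for a
        using le_m[of a q] m zero[of a q] pq(2)
        by (cases "a = q"; cases "a \<in> I") (auto simp: X_def shear_nth)
    qed (use m pq XY close \<delta> in auto)
    then have "lipschitz_joined (block_GL_pos I) (D * (3 * \<delta>)) X Y"
      by (rule lipschitz_joined_mono) (use XY D in \<open>auto intro: mult_left_mono\<close>)
    then have "lipschitz_joined (block_GL_pos I) ((1 + \<bar>t\<bar>) * (D * (3 * \<delta>))) A B"
      unfolding X_def Y_def using pq 1 by (intro lipschitz_joined_of_shear) auto
    then show ?thesis
      using t(1) by (intro weaken[of 9]) (auto simp: algebra_simps)
  next
    case 2
    have "lipschitz_joined (block_GL_pos I) (D * norm (A - B)) A B"
    proof (rule near[of p])
      show "\<bar>A $ p $ a\<bar> \<le> 7 * m" for a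
        using le_m[OF pq(1), of a] m by simp
      show "\<bar>A $ a $ p\<bar> \<le> 7 * m" for a
        using le_m[of a p] m zero[of a p] pq(1) by (cases "a \<in> I") auto
      show "norm (A - B) \<le> m / 2"
        using close \<delta> unfolding \<delta>_def by linarith
    qed (use A B pq 2 in auto)
    then show ?thesis
      by (intro weaken[of 1]) (auto simp: \<delta>_def)
  next
    case 3
    obtain i where i: "i \<in> I" "i \<noteq> p"
      using other by blast
    define X where "X = shear p i 2 (shear i p (- 2) A)"
    define Y where "Y = shear p i 2 (shear i p (- 2) B)"
    have "norm (X - Y) \<le> 3 * norm (shear i p (- 2) A - shear i p (- 2) B)"
      using norm_shear_diff_le[of p i 2] by (simp add: X_def Y_def)
    also have "\<dots> \<le> 3 * (3 * \<delta>)"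
      using norm_shear_diff_le[of i p "- 2" A B] by (simp add: \<delta>_def)
    finally have XY: "norm (X - Y) \<le> 9 * \<delta>" by simp
    have "lipschitz_joined (block_GL_pos I) (D * norm (X - Y)) X Y"
    proof (rule near[of p])
      show "X \<in> block_GL_pos I" "Y \<in> block_GL_pos I"
        unfolding X_def Y_def using A B pq i by (auto intro!: shear_block_GL_pos)
      show "m \<le> X $ p $ p" "\<bar>X $ a $ p\<bar> \<le> 7 * m" "\<bar>X $ p $ a\<bar> \<le> 7 * m" for a
        unfolding X_def by (intro negative_pivot_shears[OF A pq(1) i less_imp_le[OF m] le_m 3(2)]; assumption)+
    qed (use m pq XY close \<delta> in auto)
    then have "lipschitz_joined (block_GL_pos I) (D * (9 * \<delta>)) X Y"
      by (rule lipschitz_joined_mono) (use XY D in \<open>auto intro: mult_left_mono\<close>)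
    then have "lipschitz_joined (block_GL_pos I) ((1 + \<bar>- 2\<bar>) * ((1 + \<bar>2\<bar>) * (D * (9 * \<delta>)))) A B"
      unfolding X_def Y_def using pq i by (intro lipschitz_joined_of_shear[of _ _ I]) auto
    then show ?thesis
      by (intro weaken[of 81]) (auto simp: algebra_simps)
  qed
qed

text \<open>
  Entries of \<open>B\<close> are at most \<open>19 * norm (A - B)\<close>, so all the lengths in
  \<open>lipschitz_joined_to_positive_pivot\<close> are multiples of \<open>norm (A - B)\<close>, both for \<open>A\<close> and for \<open>B\<close>.
\<close>

lemma lipschitz_joined_of_small_entries:
  fixes A B :: "real^'n^'n"
  assumes A: "A \<in> block_GL_pos I" and B: "B \<in> block_GL_pos I"
    and pi: "p \<in> I" "i \<in> I" "i \<noteq> p"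
    and AB: "A \<noteq> B" and small: "\<And>a j. a \<in> I \<Longrightarrow> \<bar>A $ a $ j\<bar> \<le> 18 * norm (A - B)"
    and D: "0 \<le> D"
    and pivot: "\<And>X Y. X \<in> block_GL_pos I \<Longrightarrow> Y \<in> block_GL_pos I \<Longrightarrow>
      X \<in> pivot_dominates p 15 \<Longrightarrow> Y \<in> pivot_dominates p 15 \<Longrightarrow>
      lipschitz_joined (block_GL_pos I) (D * norm (X - Y)) X Y"
  defines "K \<equiv> 2 + 8 * real CARD('n)"
  shows "lipschitz_joined (block_GL_pos I) ((38 * K + D * (38 * K + 1)) * norm (A - B)) A B"
proof -
  define R where "R = 19 * norm (A - B)"
  have R: "0 < R"
    using AB by (simp add: R_def)
  have A_le: "\<bar>A $ a $ j\<bar> \<le> R" if "a \<in> I" for a j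
    using small[OF that, of j] norm_ge_zero[of "A - B"] unfolding R_def by linarith
  have B_le: "\<bar>B $ a $ j\<bar> \<le> R" if "a \<in> I" for a j
    using small[OF that, of j] entry_le_norm[of "A - B" a j] by (simp add: R_def)
  obtain A' where A': "A' \<in> block_GL_pos I" "A' \<in> pivot_dominates p 15"
    "lipschitz_joined (block_GL_pos I) (K * R) A A'"
    unfolding K_def using lipschitz_joined_to_positive_pivot[OF A pi R A_le] by blast
  obtain B' where B': "B' \<in> block_GL_pos I" "B' \<in> pivot_dominates p 15"
    "lipschitz_joined (block_GL_pos I) (K * R) B B'"
    unfolding K_def using lipschitz_joined_to_positive_pivot[OF B pi R B_le] by blast
  have "norm (A' - B') \<le> dist A A' + dist A B + dist B B'"
    using dist_triangle[of A' B' A] dist_triangle[of A B' B] by (simp add: dist_norm norm_minus_commute)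
  also have "\<dots> \<le> K * R + norm (A - B) + K * R"
    using dist_le_of_lipschitz_joined[OF A'(3)] dist_le_of_lipschitz_joined[OF B'(3)]
    by (simp add: dist_norm)
  finally have "lipschitz_joined (block_GL_pos I) (D * (K * R + norm (A - B) + K * R)) A' B'"
    by (intro lipschitz_joined_mono[OF pivot[OF A'(1) B'(1) A'(2) B'(2)]] mult_left_mono D) auto
  then have "lipschitz_joined (block_GL_pos I)
      (K * R + D * (K * R + norm (A - B) + K * R) + K * R) A B"
    by (intro lipschitz_joined_trans[OF lipschitz_joined_trans[OF A'(3)] lipschitz_joined_sym[OF B'(3)]])
  also have "K * R + D * (K * R + norm (A - B) + K * R) + K * R
      = (38 * K + D * (38 * K + 1)) * norm (A - B)"
    by (simp add: R_def algebra_simps)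
  finally show ?thesis .
qed

text \<open>
  The pivot depends on \<open>A\<close>, and so does the smaller block to which the induction hypothesis is
  applied; the sum of the finitely many constants serves for all of them.
\<close>

theorem block_GL_pos_quasiconvex:
  fixes I :: "'n::finite set"
  shows "\<exists>C\<ge>0. \<forall>A\<in>block_GL_pos I. \<forall>B\<in>block_GL_pos I.
           lipschitz_joined (block_GL_pos I) (C * norm (A - B)) A B"
proof (induction I rule: finite_psubset_induct[OF finite])
  case (1 I)
  show ?case
  proof (cases "\<exists>p. I \<subseteq> {p}")
    case True
    then show ?thesis
      using lipschitz_joined_single_entry by (intro exI[of _ 1]) auto
  next
    case False
    then have other: "\<exists>i\<in>I. i \<noteq> p" for p
      by blast
    have "\<forall>p\<in>I. \<exists>c\<ge>0. \<forall>A\<in>block_GL_pos (I - {p}). \<forall>B\<in>block_GL_pos (I - {p}).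
        lipschitz_joined (block_GL_pos (I - {p})) (c * norm (A - B)) A B"
      by (intro ballI 1) auto
    then obtain c where c: "\<And>p. p \<in> I \<Longrightarrow> 0 \<le> c p"
      "\<And>p A B. p \<in> I \<Longrightarrow> A \<in> block_GL_pos (I - {p}) \<Longrightarrow> B \<in> block_GL_pos (I - {p}) \<Longrightarrow>
        lipschitz_joined (block_GL_pos (I - {p})) (c p * norm (A - B)) A B"
      by metis
    define C0 where "C0 = sum c I"
    have C0: "0 \<le> C0"
      unfolding C0_def by (intro sum_nonneg c)
    have minor: "lipschitz_joined (block_GL_pos (I - {p})) (C0 * norm (A - B)) A B"
      if "p \<in> I" "A \<in> block_GL_pos (I - {p})" "B \<in> block_GL_pos (I - {p})" for p A B
    proof (rule lipschitz_joined_mono[OF c(2)[OF that]])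
      have "c p \<le> C0"
        unfolding C0_def using that(1) c(1) by (intro member_le_sum) auto
      then show "c p * norm (A - B) \<le> C0 * norm (A - B)"
        by (intro mult_right_mono) auto
    qed simp
    define \<kappa> where "\<kappa> = real CARD('n) * (real CARD('n) * (15\<^sup>2 + 2 * 15))"
    define D where "D = C0 * (1 + \<kappa>) + \<kappa>"
    have "0 \<le> \<kappa>"
      by (simp add: \<kappa>_def)
    then have D: "0 \<le> D"
      using C0 by (simp add: D_def)
    have pivot: "lipschitz_joined (block_GL_pos I) (D * norm (A - B)) A B"
      if "p \<in> I" "A \<in> block_GL_pos I" "B \<in> block_GL_pos I"
        "A \<in> pivot_dominates p 15" "B \<in> pivot_dominates p 15" for p A B
      unfolding D_def \<kappa>_def using that C0 by (intro lipschitz_joined_of_pivot[of p I 15 C0] minor) auto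
    define K where "K = 2 + 8 * real CARD('n)"
    define C where "C = 81 * D + (38 * K + D * (38 * K + 1))"
    have C: "81 * D \<le> C" "38 * K + D * (38 * K + 1) \<le> C" "0 \<le> C"
      using D by (auto simp: C_def K_def)
    have "lipschitz_joined (block_GL_pos I) (C * norm (A - B)) A B"
      if A: "A \<in> block_GL_pos I" and B: "B \<in> block_GL_pos I" and AB: "A \<noteq> B" for A B
    proof -
      have fin: "finite ((\<lambda>(i, j). \<bar>A $ i $ j\<bar>) ` (I \<times> I))"
        by simp
      have ne: "(\<lambda>(i, j). \<bar>A $ i $ j\<bar>) ` (I \<times> I) \<noteq> {}"
        using False by auto
      define m where "m = Max ((\<lambda>(i, j). \<bar>A $ i $ j\<bar>) ` (I \<times> I))"
      obtain p q where pq: "p \<in> I" "q \<in> I" "\<bar>A $ p $ q\<bar> = m"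
        using Max_in[OF fin ne] unfolding m_def[symmetric] by auto
      have m0: "0 \<le> m"
        using pq(3) by simp
      have le_m: "\<bar>A $ a $ j\<bar> \<le> m" if "a \<in> I" for a j
      proof (cases "j \<in> I")
        case True
        with that show ?thesis
          unfolding m_def by (intro Max_ge fin) auto
      next
        case False
        with that A m0 show ?thesis
          by (auto simp: block_GL_pos_def)
      qed
      have weaken: "lipschitz_joined (block_GL_pos I) (C * norm (A - B)) A B"
        if "lipschitz_joined (block_GL_pos I) (c * norm (A - B)) A B" "c \<le> C" for c
        using that by (intro lipschitz_joined_mono[OF that(1)] mult_right_mono) auto
      show ?thesis
      proof (cases "18 * norm (A - B) \<le> m")
        case True
        moreover have "0 < norm (A - B)"
          using AB by simp
        ultimately have "0 < m"
          by linarith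
        then show ?thesis
          using True le_m unfolding pq(3)[symmetric]
          by (intro weaken[OF lipschitz_joined_of_large_entry[OF A B pq(1,2) other] C(1)] D pivot)
      next
        case small: False
        obtain i where i: "i \<in> I" "i \<noteq> p"
          using other by blast
        show ?thesis
        proof (rule weaken[OF lipschitz_joined_of_small_entries[OF A B pq(1) i AB _ D] C(2)[unfolded K_def]])
          show "\<bar>A $ a $ j\<bar> \<le> 18 * norm (A - B)" if "a \<in> I" for a j
            using le_m[OF that, of j] small by linarith
        qed (rule pivot[OF pq(1)])
      qed
    qed
    moreover have "lipschitz_joined (block_GL_pos I) (C * norm (A - A)) A A"
      if "A \<in> block_GL_pos I" for A
      using lipschitz_joined_segment[of A A "block_GL_pos I"] that by simp
    ultimately show ?thesis
      using C(3) by metis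
  qed
qed

theorem theorem1p1:
  shows "\<exists>C::real. \<forall>A\<in>GL_pos. \<forall>B\<in>(GL_pos :: (real^'n^'n) set).
           A \<noteq> B \<longrightarrow> intrinsic_dist GL_pos A B < ennreal (C * norm (A - B))"
proof -
  have block: "block_GL_pos UNIV = (GL_pos :: (real^'n^'n) set)"
    by (simp add: block_GL_pos_def GL_pos_def)
  obtain C where C: "0 \<le> C" "\<And>A B :: real^'n^'n. A \<in> GL_pos \<Longrightarrow> B \<in> GL_pos \<Longrightarrow>
      lipschitz_joined GL_pos (C * norm (A - B)) A B"
    using block_GL_pos_quasiconvex[of "UNIV :: 'n set"] unfolding block by blast
  show ?thesis
  proof (intro exI[of _ "C + 1"] ballI impI)
    fix A B :: "real^'n^'n"
    assume AB: "A \<in> GL_pos" "B \<in> GL_pos" "A \<noteq> B"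
    \<comment> \<open>The constant is increased by one only to make the inequality strict.\<close>
    have "intrinsic_dist GL_pos A B \<le> ennreal (C * norm (A - B))"
      using AB by (intro intrinsic_dist_le_of_lipschitz_joined C)
    also have "\<dots> < ennreal ((C + 1) * norm (A - B))"
      using C(1) AB(3) by (intro ennreal_lessI mult_pos_pos mult_strict_right_mono) auto
    finally show "intrinsic_dist GL_pos A B < ennreal ((C + 1) * norm (A - B))" .
  qed
qed

end
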